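(* For any complex numbers $a,b$, define $$P(a,b)=(q,a,b;q)_\infty\sum_{n=0}^\infty\frac{(ab/q^3;q)_{2n}}{(q,a,b,ab/q^3;q)_n}\,q^n.$$ Then $$\theta(q,a)=\frac{q}{q+b}P(a,b)+\frac{b(1+q)}{q+b}P(aq,bq)+\frac{b^2q}{q+b}P(aq^2,bq^2).$$
   Context: Here $q$ is a fixed complex number with $0<|q|<1$, and parameters are assumed to be such that no denominator vanishes (in particular $q+b\ne0$). Notation: $(x;q)_\infty=\prod_{n\ge0}(1-xq^n)$, $(x;q)_n=(x;q)_\infty/(xq^n;q)_\infty$, and $(a_1,\ldots,a_m;q)_n=(a_1;q)_n\cdots(a_m;q)_n$ for $n$ an integer or $\infty$. The partial theta function is $\theta(q,x)=\sum_{n=0}^\infty\tau(n)x^n$ with $\tau(n)=(-1)^nq^{n(n-1)/2}$. *)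

theory Defs
  imports "HOL-Analysis.Analysis"
begin

definition qpoch_inf :: "complex \<Rightarrow> complex \<Rightarrow> complex" where
  "qpoch_inf q x = (\<Prod>n. 1 - x * q ^ n)"

text \<open>
  The ratio is the usual $(x;q)_n$ only where the denominator is nonzero; elsewhere HOL's
  convention $z / 0 = 0$ applies.
\<close>

definition qpoch :: "complex \<Rightarrow> complex \<Rightarrow> int \<Rightarrow> complex" where
  "qpoch q x n = qpoch_inf q x / qpoch_inf q (x * q powi n)"

definition qpochs_inf :: "complex \<Rightarrow> complex list \<Rightarrow> complex" where
  "qpochs_inf q xs = (\<Prod>x\<leftarrow>xs. qpoch_inf q x)"

definition qpochs :: "complex \<Rightarrow> complex list \<Rightarrow> int \<Rightarrow> complex" where
  "qpochs q xs n = (\<Prod>x\<leftarrow>xs. qpoch q x n)"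

definition partial_theta_coeff :: "complex \<Rightarrow> nat \<Rightarrow> complex" where
  "partial_theta_coeff q n = (-1) ^ n * q ^ (n * (n - 1) div 2)"

definition partial_theta :: "complex \<Rightarrow> complex \<Rightarrow> complex" where
  "partial_theta q x = (\<Sum>n. partial_theta_coeff q n * x ^ n)"

definition P :: "complex \<Rightarrow> complex \<Rightarrow> complex \<Rightarrow> complex" where
  "P q a b = qpochs_inf q [q, a, b] *
     (\<Sum>n. qpoch q (a * b / q ^ 3) (2 * int n) / qpochs q [q, a, b, a * b / q ^ 3] (int n) * q ^ n)"

end

theory Submission
  imports Defs
begin

text \<open>
  Write $T$ for the shift $(a,b) \mapsto (aq,bq)$. Since $bT\,bT = q\,b^2T^2$, the right-hand side
  of the theorem, multiplied by $q+b$, is $(q+bT)(1+bT)P$. The two factors can be applied one after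
  the other, because the intermediate result is expressible by the series
  $$V(a,b) = (q,a,b;q)_\infty \sum_{n\ge0} \frac{(abq^{n-2};q)_n}{(q,a,b;q)_n}\,q^n,$$
  which is $P$ with $ab/q^3$ replaced by $ab/q^2$. Two relations carry the proof:
  $$P(a,b) + bP(aq,bq) = V(a,b/q) + (b/q)\,V(a,b), \qquad V(a,b) + bV(aq,bq) = \theta(q,a)$$
  (lemmas \<open>qseries_contiguous\<close> and \<open>partial_theta_eq_V\<close>). Applying $q+bT$ to the first one gives
  $$q\,\bigl(V(a,b/q) + (b/q)V(aq,b)\bigr) + b\,\bigl(V(a,b) + bV(aq,bq)\bigr),$$
  and by the second relation, used at $(a,b/q)$ and at $(a,b)$, this is $(q+b)\,\theta(q,a)$.

  The first relation holds because the difference of the summands of its two sides telescopes.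
  For the second one, $\theta(q,\cdot)$ is characterised by $L(a) = 1 - aL(aq)$ together with
  boundedness along $a, aq, aq^2, \dots$: iterating the equation produces the partial sums of
  $\theta(q,a)$, with a remainder that tends to $0$. That $V(a,b) + bV(aq,bq)$ satisfies this
  equation in $a$ (lemma \<open>V_recurrence\<close>) is again a telescoping sum.
\<close>

section \<open>The infinite q-shifted factorial\<close>

lemma qpoch_inf_convergent:
  fixes q x :: complex
  assumes "norm q < 1"
  shows "convergent_prod (\<lambda>n. 1 - x * q ^ n)"
proof -
  have "norm ((1 - x * q ^ n) - 1) = norm x * norm q ^ n" for n
    by (simp add: norm_mult norm_power)
  moreover have "summable (\<lambda>n. norm x * norm q ^ n)"
    using assms by (intro summable_mult summable_geometric) simp
  ultimately have "summable (\<lambda>n. norm ((1 - x * q ^ n) - 1))"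
    by presburger
  then show ?thesis
    by (intro abs_convergent_prod_imp_convergent_prod summable_imp_abs_convergent_prod)
qed

lemma qpoch_inf_LIMSEQ:
  assumes "norm q < 1"
  shows "(\<lambda>n. \<Prod>k<n. 1 - x * q ^ k) \<longlonglongrightarrow> qpoch_inf q x"
proof -
  have "(\<lambda>n. \<Prod>k\<le>n. 1 - x * q ^ k) \<longlonglongrightarrow> qpoch_inf q x"
    unfolding qpoch_inf_def by (rule convergent_prod_LIMSEQ[OF qpoch_inf_convergent[OF assms]])
  then show ?thesis
    by (subst (asm) lessThan_Suc_atMost[symmetric]) (rule LIMSEQ_imp_Suc)
qed

lemma qpoch_inf_nonzero:
  assumes "norm q < 1" and "\<And>k::nat. x * q ^ k \<noteq> 1"
  shows "qpoch_inf q x \<noteq> 0"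
  unfolding qpoch_inf_def
  using prodinf_nonzero[OF qpoch_inf_convergent[OF assms(1)]] assms(2) by (metis eq_iff_diff_eq_0)

lemma qpoch_inf_step:
  assumes "norm q < 1"
  shows "qpoch_inf q x = (1 - x) * qpoch_inf q (x * q)"
proof -
  have "(\<lambda>n. (1 - x) * (\<Prod>k<n. 1 - (x * q) * q ^ k)) \<longlonglongrightarrow> (1 - x) * qpoch_inf q (x * q)"
    by (intro tendsto_intros qpoch_inf_LIMSEQ assms)
  moreover have "(1 - x) * (\<Prod>k<n. 1 - (x * q) * q ^ k) = (\<Prod>k<Suc n. 1 - x * q ^ k)" for n
    by (subst prod.lessThan_Suc_shift) (simp add: mult.assoc)
  ultimately have "(\<lambda>n. \<Prod>k<Suc n. 1 - x * q ^ k) \<longlonglongrightarrow> (1 - x) * qpoch_inf q (x * q)"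
    by simp
  then show ?thesis
    using LIMSEQ_Suc[OF qpoch_inf_LIMSEQ[OF assms, of x]] LIMSEQ_unique by blast
qed

lemma qpoch_inf_split:
  assumes "norm q < 1"
  shows "qpoch_inf q x = (\<Prod>k<n. 1 - x * q ^ k) * qpoch_inf q (x * q ^ n)"
proof (induction n)
  case (Suc n)
  then show ?case
    using qpoch_inf_step[OF assms, of "x * q ^ n"] by (simp add: mult_ac)
qed simp

text \<open>
  A bound independent of $n$, so that it serves the finite products inside the summands and, in
  the limit, the infinite ones.
\<close>

lemma norm_qprod_minus1_le:
  fixes q x :: complex
  assumes "norm q < 1"
  shows "norm ((\<Prod>k<n. 1 - x * q ^ k) - 1) \<le> exp (norm x / (1 - norm q)) - 1"
proof -
  have "norm ((\<Prod>k<n. 1 + - (x * q ^ k)) - 1) \<le> (\<Prod>k<n. 1 + norm (- (x * q ^ k))) - 1"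
    by (rule norm_prod_minus1_le_prod_minus1)
  also have "(\<Prod>k<n. 1 + norm (- (x * q ^ k))) \<le> exp (\<Sum>k<n. norm (- (x * q ^ k)))"
    by (rule prod_le_exp_sum) simp
  also have "(\<Sum>k<n. norm (- (x * q ^ k))) = norm x * (\<Sum>k<n. norm q ^ k)"
    by (simp add: norm_mult norm_power sum_distrib_left)
  also have "\<dots> \<le> norm x * (\<Sum>k. norm q ^ k)"
    using assms by (intro mult_left_mono sum_le_suminf summable_geometric) auto
  also have "\<dots> = norm x / (1 - norm q)"
    using assms by (simp add: suminf_geometric)
  finally show ?thesis by simp
qed

lemma norm_qprod_le:
  fixes q x :: complex
  assumes "norm q < 1"
  shows "norm (\<Prod>k<n. 1 - x * q ^ k) \<le> exp (norm x / (1 - norm q))"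
  using norm_qprod_minus1_le[OF assms, of x n] norm_triangle_ineq2[of "\<Prod>k<n. 1 - x * q ^ k" 1]
  by simp

lemma norm_qpoch_inf_le:
  assumes "norm q < 1"
  shows "norm (qpoch_inf q x) \<le> exp (norm x / (1 - norm q))"
  by (rule LIMSEQ_le_const2[OF tendsto_norm[OF qpoch_inf_LIMSEQ[OF assms]]])
     (use norm_qprod_le[OF assms] in blast)

text \<open>
  Continuity of $(x;q)_\infty$ at $x=0$; it yields the limits of the telescoping sums below.
\<close>

lemma qpoch_inf_tendsto_1:
  assumes "norm q < 1" and "f \<longlonglongrightarrow> 0"
  shows "(\<lambda>n. qpoch_inf q (f n)) \<longlonglongrightarrow> 1"
proof -
  have bound: "norm (qpoch_inf q x - 1) \<le> exp (norm x / (1 - norm q)) - 1" for x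
    by (rule LIMSEQ_le_const2[OF tendsto_norm[OF tendsto_diff[OF qpoch_inf_LIMSEQ[OF assms(1)] tendsto_const]]])
       (use norm_qprod_minus1_le[OF assms(1)] in blast)
  have "(\<lambda>n. exp (norm (f n) / (1 - norm q)) - 1) \<longlonglongrightarrow> exp (norm (0::complex) / (1 - norm q)) - 1"
    using assms by (intro tendsto_intros) auto
  then have "(\<lambda>n. exp (norm (f n) / (1 - norm q)) - 1) \<longlonglongrightarrow> 0"
    by simp
  then have "(\<lambda>n. qpoch_inf q (f n) - 1) \<longlonglongrightarrow> 0"
    by (rule Lim_null_comparison[rotated]) (use bound in simp)
  then show ?thesis
    by (simp add: LIM_zero_iff)
qed

section \<open>The basic hypergeometric series behind P\<close>

text \<open>
  The prefactor $(q,a,b;q)_\infty$ is absorbed into the summand, which cancels all its denominators: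
  $(a;q)_\infty/(a;q)_n = (aq^n;q)_\infty$, and $(c;q)_{2n}/(c;q)_n = (cq^n;q)_n$. In this form the
  series converges for all $a$, $b$, $c$. Keeping $c$ as a separate argument covers both
  $c = ab/q^3$ and $c = ab/q^2$.
\<close>

definition qsummand :: "complex \<Rightarrow> complex \<Rightarrow> complex \<Rightarrow> complex \<Rightarrow> nat \<Rightarrow> complex" where
  "qsummand q a b c n =
     q ^ n * qpoch_inf q (q * q ^ n) * qpoch_inf q (a * q ^ n) * qpoch_inf q (b * q ^ n)
       * (\<Prod>k<n. 1 - c * q ^ n * q ^ k)"

definition qseries :: "complex \<Rightarrow> complex \<Rightarrow> complex \<Rightarrow> complex \<Rightarrow> complex" where
  "qseries q a b c = (\<Sum>n. qsummand q a b c n)"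

lemma norm_qsummand_le:
  assumes "norm q < 1" "norm a \<le> A" "norm b \<le> B" "norm c \<le> C"
  shows "norm (qsummand q a b c n) \<le> exp ((1 + A + B + C) / (1 - norm q)) * norm q ^ n"
proof -
  let ?e = "\<lambda>x. exp (x / (1 - norm q))"
  have pow: "norm q ^ n \<le> 1"
    using assms(1) by (simp add: power_le_one)
  have shrink: "norm (x * q ^ n) \<le> X" if "norm x \<le> X" for x X
  proof -
    have "norm x * norm q ^ n \<le> norm x * 1"
      using pow by (rule mult_left_mono) simp
    with that show ?thesis by (simp add: norm_mult norm_power)
  qed
  have inf: "norm (qpoch_inf q (x * q ^ n)) \<le> ?e X" if "norm x \<le> X" for x X
    by (rule order_trans[OF norm_qpoch_inf_le[OF assms(1)]])
       (use shrink[OF that] assms(1) in \<open>simp add: divide_right_mono\<close>)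
  have fin: "norm (\<Prod>k<n. 1 - c * q ^ n * q ^ k) \<le> ?e C"
    by (rule order_trans[OF norm_qprod_le[OF assms(1)]])
       (use shrink[OF assms(4)] assms(1) in \<open>simp add: divide_right_mono\<close>)
  have "norm (qsummand q a b c n) \<le> norm q ^ n * ?e 1 * ?e A * ?e B * ?e C"
    unfolding qsummand_def norm_mult norm_power
    by (intro mult_mono inf fin assms order.refl less_imp_le[OF assms(1)]) simp_all
  also have "\<dots> = exp ((1 + A + B + C) / (1 - norm q)) * norm q ^ n"
    by (simp add: exp_add add_divide_distrib)
  finally show ?thesis .
qed

lemma summable_qsummand:
  assumes "norm q < 1"
  shows "summable (qsummand q a b c)"
  by (rule summable_comparison_test'[OF _ norm_qsummand_le[OF assms order.refl order.refl order.refl]])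
     (use assms in \<open>intro summable_mult summable_geometric; simp\<close>)

text \<open>
  The bound grows with the norms of the arguments, hence it is uniform along $a, aq, aq^2, \dots$.
\<close>

lemma norm_qseries_le:
  assumes "norm q < 1" "norm a \<le> A" "norm b \<le> B" "norm c \<le> C"
  shows "norm (qseries q a b c) \<le> exp ((1 + A + B + C) / (1 - norm q)) / (1 - norm q)"
proof -
  have "(\<lambda>n. exp ((1 + A + B + C) / (1 - norm q)) * norm q ^ n)
          sums (exp ((1 + A + B + C) / (1 - norm q)) * (1 / (1 - norm q)))"
    by (intro sums_mult geometric_sums) (use assms(1) in simp)
  then show ?thesis
    unfolding qseries_def
    using norm_suminf_le[OF norm_qsummand_le[OF assms] sums_summable] sums_unique by fastforce
qed

lemma qpoch_inf_square_nonzero: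
  assumes "norm q < 1" and "\<And>k::nat. y * q ^ k \<noteq> 1"
  shows "qpoch_inf q (y * (q ^ n) ^ 2) \<noteq> 0"
proof (rule qpoch_inf_nonzero[OF assms(1)])
  show "y * (q ^ n) ^ 2 * q ^ k \<noteq> 1" for k
    using assms(2)[of "n * 2 + k"] by (simp add: power_add power_mult mult.assoc)
qed

text \<open>
  Completing the finite product to a quotient of infinite ones makes every factor of the summand
  a function of $x = q^n$ alone, so that shifting $a$, $b$, $c$ or $n$ only ever moves a factor
  along $y \mapsto yq$.
\<close>

lemma qsummand_eq_quotient:
  assumes "norm q < 1" and "\<And>k::nat. c * q ^ k \<noteq> 1" and "x = q ^ n"
  shows "qsummand q a b c n =
           x * qpoch_inf q (q * x) * qpoch_inf q (a * x) * qpoch_inf q (b * x)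
             * qpoch_inf q (c * x) * inverse (qpoch_inf q (c * x ^ 2))"
  using qpoch_inf_square_nonzero[OF assms(1,2), of n] qpoch_inf_split[OF assms(1), of "c * q ^ n" n]
  by (simp add: qsummand_def assms(3) power2_eq_square mult.assoc)

text \<open>
  The hypotheses keep every denominator of $P$ away from $0$, so each quotient
  $(x;q)_\infty/(xq^n;q)_\infty$ occurring in it is the finite product $(x;q)_n$.
\<close>

lemma P_eq_qseries:
  assumes "norm q < 1" and q0: "q \<noteq> 0"
    and a: "\<And>k::nat. a * q ^ k \<noteq> 1" and b: "\<And>k::nat. b * q ^ k \<noteq> 1"
    and c: "\<And>k::nat. a * b / q ^ 3 * q ^ k \<noteq> 1"
  shows "P q a b = qseries q a b (a * b / q ^ 3)"
proof -
  define c' where "c' = a * b / q ^ 3"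
  note inf0 = qpoch_inf_nonzero[OF assms(1)]
  have qk: "q * q ^ k \<noteq> 1" for k :: nat
  proof -
    have "norm (q * q ^ k) < 1"
      using assms(1) by (simp flip: power_Suc add: norm_power power_less_one_iff)
    then show ?thesis by auto
  qed
  have c: "c' * q ^ k \<noteq> 1" for k :: nat
    using c by (simp add: c'_def)
  have nz: "qpoch_inf q q \<noteq> 0" "qpoch_inf q a \<noteq> 0" "qpoch_inf q b \<noteq> 0" "qpoch_inf q c' \<noteq> 0"
    using qk a b c by (auto intro!: inf0)
  have nzn: "qpoch_inf q (x * q ^ n) \<noteq> 0" if "\<And>k::nat. x * q ^ k \<noteq> 1" for x n
    by (rule inf0) (metis that mult.assoc power_add)
  have summand: "qpochs_inf q [q, a, b] *
      (qpoch q c' (2 * int n) / qpochs q [q, a, b, c'] (int n) * q ^ n) = qsummand q a b c' n" for n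
  proof -
    have p2: "q powi (2 * int n) = (q ^ n) ^ 2"
      by (metis mult.commute of_nat_mult of_nat_numeral power_int_of_nat power_mult)
    show ?thesis
      unfolding qsummand_eq_quotient[OF assms(1) c refl] qpoch_def p2 qpochs_def qpochs_inf_def
      using nz nzn[OF qk] nzn[OF a] nzn[OF b] nzn[OF c] qpoch_inf_square_nonzero[OF assms(1) c]
      by (simp add: field_simps)
  qed
  have nz3: "qpochs_inf q [q, a, b] \<noteq> 0"
    using nz by (simp add: qpochs_inf_def)
  have "P q a b = qpochs_inf q [q, a, b] *
          (\<Sum>n. qpoch q c' (2 * int n) / qpochs q [q, a, b, c'] (int n) * q ^ n)"
    by (simp add: P_def c'_def)
  also have "\<dots> = (\<Sum>n. qsummand q a b c' n)"
    unfolding summand[symmetric]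
    by (rule suminf_mult[symmetric], rule summable_mult_D[OF _ nz3])
       (simp only: summand summable_qsummand[OF assms(1)])
  finally show ?thesis
    by (simp add: qseries_def c'_def)
qed

section \<open>Relations proved by telescoping\<close>

lemma qpoch_inf_1:
  assumes "norm q < 1" shows "qpoch_inf q 1 = 0"
  using qpoch_inf_step[OF assms, of 1] by simp

lemma qpoch_inf_step_mult:
  assumes "norm q < 1"
  shows "qpoch_inf q (y * x) = (1 - y * x) * qpoch_inf q (y * q * x)"
  using qpoch_inf_step[OF assms, of "y * x"] by (simp add: mult_ac)

lemma inverse_qpoch_inf_step_mult:
  assumes "norm q < 1" and "qpoch_inf q (y * x) \<noteq> 0"
  shows "inverse (qpoch_inf q (y * q * x)) = (1 - y * x) * inverse (qpoch_inf q (y * x))"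
proof -
  note step = qpoch_inf_step_mult[OF assms(1), of y x]
  have "1 - y * x \<noteq> 0"
    using step assms(2) by auto
  then show ?thesis
    by (simp add: step)
qed

lemma sums_telescope_zero:
  fixes g :: "nat \<Rightarrow> 'a :: real_normed_vector"
  assumes "\<And>n. f n = g (Suc n) - g n" and "g 0 = 0" and "g \<longlonglongrightarrow> l"
  shows "f sums l"
proof -
  have "f = (\<lambda>n. g (Suc n) - g n)"
    using assms(1) by (rule ext)
  then show ?thesis
    using telescope_sums[OF assms(3)] assms(2) by simp
qed

text \<open>
  As a power series, $V(a,b) = \sum_{n,k\ge0} (-1)^{n+k} q^{(n+k)(n+k-1)/2}\, a^n b^k$: adding
  $bV(aq,bq)$ cancels every term with $k \ge 1$, which leaves $\theta(q,a)$. The expansion is what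
  suggests this series; the proofs work with the sum itself.
\<close>

definition V :: "complex \<Rightarrow> complex \<Rightarrow> complex \<Rightarrow> complex" where
  "V q a b = qseries q a b (a * b / q ^ 2)"

lemma tendsto_pow_0:
  fixes q x :: complex
  assumes "norm q < 1"
  shows "(\<lambda>n. x * q ^ n) \<longlonglongrightarrow> 0" "(\<lambda>n. x * (q ^ n) ^ 2) \<longlonglongrightarrow> 0"
proof -
  have "(\<lambda>n. q ^ n) \<longlonglongrightarrow> 0"
    by (rule LIMSEQ_power_zero[OF assms])
  note lim = tendsto_mult[OF tendsto_const this] tendsto_mult[OF tendsto_const tendsto_power[OF this]]
  show "(\<lambda>n. x * q ^ n) \<longlonglongrightarrow> 0" "(\<lambda>n. x * (q ^ n) ^ 2) \<longlonglongrightarrow> 0"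
    using lim(1)[of x] lim(2)[of x 2] by simp_all
qed

text \<open>
  The left-hand side is $L(a) + aL(aq)$ for $L(a) = V(a,b) + bV(aq,bq)$. All four summands are
  rational multiples of one another, and the combination has an antidifference of the same kind,
  which goes from $0$ at $n=0$ to $1$ at infinity.
\<close>

lemma V_recurrence:
  assumes nq: "norm q < 1" and q0: "q \<noteq> 0" and cnz: "\<And>k::nat. a * b / q ^ 2 * q ^ k \<noteq> 1"
  shows "(V q a b + b * V q (a * q) (b * q)) + a * (V q (a * q) b + b * V q (a * q * q) (b * q)) = 1"
proof -
  \<comment> \<open>With $b = dq^2$ and $c = ad$ the relation $c = ab/q^2$ involves no division, so that the identities in $x = q^n$ below are between polynomials.\<close>
  define d where "d = b / q ^ 2"
  have b: "b = d * q ^ 2"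
    using q0 by (simp add: d_def)
  define c where "c = a * d"
  have c0: "c * q ^ k \<noteq> 1" for k
    using cnz[of k] by (simp add: c_def d_def)
  have c1: "c * q * q ^ k \<noteq> 1" and c2: "c * q * q * q ^ k \<noteq> 1" and c3: "c * q * q * q * q ^ k \<noteq> 1" for k
    using c0[of "Suc k"] c0[of "Suc (Suc k)"] c0[of "Suc (Suc (Suc k))"] by (simp_all add: mult.assoc)
  define f where "f n = qsummand q a b c n + b * qsummand q (a * q) (b * q) (c * q * q) n
      + a * (qsummand q (a * q) b (c * q) n + b * qsummand q (a * q * q) (b * q) (c * q * q * q) n)" for n
  \<comment> \<open>The infinite products are forced by Gosper's algorithm; the cubic polynomial in $q^n$ is the solution of the remaining linear system. The first factor vanishes at $n = 0$ because $(1;q)_\infty = 0$.\<close>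
  define g where "g n = qpoch_inf q (1 * q ^ n) * qpoch_inf q (a * q * q ^ n) * qpoch_inf q (b * q ^ n)
      * qpoch_inf q (c * q * q * q ^ n) * inverse (qpoch_inf q (c * (q ^ n) ^ 2))
      * (1 - a * q ^ n + a * c * q * (q ^ n) ^ 2 - c ^ 2 * q * (q ^ n) ^ 3)" for n
  have step: "f n = g (Suc n) - g n" for n
  proof -
    define x where "x = q ^ n"
    define A where "A = qpoch_inf q (a * q * q * x)"
    define B where "B = qpoch_inf q (b * q * x)"
    define C where "C = qpoch_inf q (c * q * q * q * x)"
    define E where "E = inverse (qpoch_inf q (c * x ^ 2))"
    define Q where "Q = qpoch_inf q (q * x)"
    note step = qpoch_inf_step_mult[OF nq]
      and shift = inverse_qpoch_inf_step_mult[OF nq qpoch_inf_square_nonzero[OF nq], of _ n, folded x_def]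
    have As: "qpoch_inf q (a * q * x) = (1 - a * q * x) * A"
         "qpoch_inf q (a * x) = (1 - a * x) * ((1 - a * q * x) * A)"
      using step[of a x] step[of "a * q" x] by (simp_all add: A_def)
    have Bs: "qpoch_inf q (b * x) = (1 - b * x) * B"
      using step[of b x] by (simp add: B_def)
    have Qs: "qpoch_inf q (1 * x) = (1 - x) * Q"
      using step[of 1 x] by (simp add: Q_def)
    have Cs: "qpoch_inf q (c * q * q * x) = (1 - c * q * q * x) * C"
         "qpoch_inf q (c * q * x) = (1 - c * q * x) * ((1 - c * q * q * x) * C)"
         "qpoch_inf q (c * x) = (1 - c * x) * ((1 - c * q * x) * ((1 - c * q * q * x) * C))"
      using step[of c x] step[of "c * q" x] step[of "c * q * q" x]
      by (simp_all add: C_def)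
    have Es: "inverse (qpoch_inf q (c * q * x ^ 2)) = (1 - c * x ^ 2) * E"
         "inverse (qpoch_inf q (c * q * q * x ^ 2)) = (1 - c * q * x ^ 2) * ((1 - c * x ^ 2) * E)"
         "inverse (qpoch_inf q (c * q * q * q * x ^ 2)) =
            (1 - c * q * q * x ^ 2) * ((1 - c * q * x ^ 2) * ((1 - c * x ^ 2) * E))"
      using shift[OF c0] shift[OF c1] shift[OF c2] by (simp_all add: E_def)
    note vals = As Bs Qs Cs Es A_def[symmetric] B_def[symmetric] Q_def[symmetric]
      C_def[symmetric] E_def[symmetric]
    have t: "qsummand q a b c n = x * Q * ((1 - a * x) * ((1 - a * q * x) * A)) * ((1 - b * x) * B)
        * ((1 - c * x) * ((1 - c * q * x) * ((1 - c * q * q * x) * C))) * E"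
      "qsummand q (a * q) b (c * q) n = x * Q * ((1 - a * q * x) * A) * ((1 - b * x) * B)
        * ((1 - c * q * x) * ((1 - c * q * q * x) * C)) * ((1 - c * x ^ 2) * E)"
      "qsummand q (a * q) (b * q) (c * q * q) n = x * Q * ((1 - a * q * x) * A) * B
        * ((1 - c * q * q * x) * C) * ((1 - c * q * x ^ 2) * ((1 - c * x ^ 2) * E))"
      "qsummand q (a * q * q) (b * q) (c * q * q * q) n = x * Q * A * B * C
        * ((1 - c * q * q * x ^ 2) * ((1 - c * q * x ^ 2) * ((1 - c * x ^ 2) * E)))"
      unfolding qsummand_eq_quotient[OF nq c0 x_def] qsummand_eq_quotient[OF nq c1 x_def]
        qsummand_eq_quotient[OF nq c2 x_def] qsummand_eq_quotient[OF nq c3 x_def] vals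
      by (rule refl)+
    have g0: "g n = (1 - x) * Q * ((1 - a * q * x) * A) * ((1 - b * x) * B) * ((1 - c * q * q * x) * C)
        * E * (1 - a * x + a * c * q * x ^ 2 - c ^ 2 * q * x ^ 3)"
      unfolding g_def x_def[symmetric] vals by (rule refl)
    have g1: "g (Suc n) = Q * A * B * C * ((1 - c * q * x ^ 2) * ((1 - c * x ^ 2) * E))
        * (1 - a * (q * x) + a * c * q * (q * x) ^ 2 - c ^ 2 * q * (q * x) ^ 3)"
    proof -
      have qx: "q ^ Suc n = q * x" and assoc: "y * (q * x) = y * q * x" "c * (q * x) ^ 2 = c * q * q * x ^ 2" for y
        by (simp_all add: x_def power2_eq_square mult_ac)
      show ?thesis
        unfolding g_def qx assoc mult_1 vals by (rule refl)
    qed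
    \<comment> \<open>All terms share the factor $QABCE$; what remains is a polynomial identity.\<close>
    let ?U = "Q * A * B * C * E"
    have "f n = ?U * (x * (1 - a * x) * (1 - a * q * x) * (1 - b * x) * (1 - c * x) * (1 - c * q * x) * (1 - c * q * q * x)
        + b * (x * (1 - a * q * x) * (1 - c * q * q * x) * (1 - c * q * x ^ 2) * (1 - c * x ^ 2))
        + a * (x * (1 - a * q * x) * (1 - b * x) * (1 - c * q * x) * (1 - c * q * q * x) * (1 - c * x ^ 2)
              + b * (x * (1 - c * q * q * x ^ 2) * (1 - c * q * x ^ 2) * (1 - c * x ^ 2))))"
      unfolding f_def t by (simp only: distrib_left mult_ac)
    moreover have "g (Suc n) = ?U * ((1 - c * q * x ^ 2) * (1 - c * x ^ 2) * (1 - a * (q * x) + a * c * q * (q * x) ^ 2 - c ^ 2 * q * (q * x) ^ 3))"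
      unfolding g1 by (simp only: mult_ac)
    moreover have "g n = ?U * ((1 - x) * (1 - a * q * x) * (1 - b * x) * (1 - c * q * q * x) * (1 - a * x + a * c * q * x ^ 2 - c ^ 2 * q * x ^ 3))"
      unfolding g0 by (simp only: mult_ac)
    moreover have "x * (1 - a * x) * (1 - a * q * x) * (1 - b * x) * (1 - c * x) * (1 - c * q * x) * (1 - c * q * q * x)
        + b * (x * (1 - a * q * x) * (1 - c * q * q * x) * (1 - c * q * x ^ 2) * (1 - c * x ^ 2))
        + a * (x * (1 - a * q * x) * (1 - b * x) * (1 - c * q * x) * (1 - c * q * q * x) * (1 - c * x ^ 2)
              + b * (x * (1 - c * q * q * x ^ 2) * (1 - c * q * x ^ 2) * (1 - c * x ^ 2)))
        = (1 - c * q * x ^ 2) * (1 - c * x ^ 2) * (1 - a * (q * x) + a * c * q * (q * x) ^ 2 - c ^ 2 * q * (q * x) ^ 3)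
          - (1 - x) * (1 - a * q * x) * (1 - b * x) * (1 - c * q * q * x) * (1 - a * x + a * c * q * x ^ 2 - c ^ 2 * q * x ^ 3)"
      unfolding b c_def by algebra
    ultimately show ?thesis
      by (simp only: right_diff_distrib[of ?U])
  qed
  have lim: "g \<longlonglongrightarrow> 1"
  proof -
    have "g \<longlonglongrightarrow> 1 * 1 * 1 * 1 * inverse 1 * (1 - a * 0 + a * c * q * 0 ^ 2 - c ^ 2 * q * 0 ^ 3)"
      unfolding g_def
      by (intro tendsto_intros qpoch_inf_tendsto_1[OF nq] tendsto_pow_0[OF nq] LIMSEQ_power_zero[OF nq]) simp
    then show ?thesis by simp
  qed
  have "f sums 1"
    by (rule sums_telescope_zero[OF step _ lim]) (simp add: g_def qpoch_inf_1[OF nq])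
  moreover have "f sums (qseries q a b c + b * qseries q (a * q) (b * q) (c * q * q)
      + a * (qseries q (a * q) b (c * q) + b * qseries q (a * q * q) (b * q) (c * q * q * q)))"
    unfolding f_def qseries_def
    by (intro sums_add sums_mult summable_sums summable_qsummand[OF nq])
  ultimately have "1 = qseries q a b c + b * qseries q (a * q) (b * q) (c * q * q)
      + a * (qseries q (a * q) b (c * q) + b * qseries q (a * q * q) (b * q) (c * q * q * q))"
    by (rule sums_unique2)
  moreover have "a * q * b / q ^ 2 = c * q" "a * q * (b * q) / q ^ 2 = c * q * q"
      "a * q * q * (b * q) / q ^ 2 = c * q * q * q" "a * b / q ^ 2 = c"
    using q0 by (simp_all add: c_def d_def field_simps power2_eq_square)
  ultimately show ?thesis
    by (simp only: V_def)
qed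

text \<open>
  With $b/q$ in place of $b$, the left-hand side becomes $P(a,b) + bP(aq,bq)$. Here the
  antidifference of the difference of both sides vanishes at $n=0$ and at infinity.
\<close>

lemma qseries_contiguous:
  assumes nq: "norm q < 1" and q0: "q \<noteq> 0" and cnz: "\<And>k::nat. a * b / q ^ 2 * q ^ k \<noteq> 1"
  shows "qseries q a (b * q) (a * b / q ^ 2) + b * q * qseries q (a * q) (b * q * q) (a * b)
       = V q a b + b * V q a (b * q)"
proof -
  \<comment> \<open>With $b = dq^2$ and $c = ad$ the relation $c = ab/q^2$ involves no division, so that the identities in $x = q^n$ below are between polynomials.\<close>
  define d where "d = b / q ^ 2"
  have b: "b = d * q ^ 2"
    using q0 by (simp add: d_def)
  define c where "c = a * d"
  have c0: "c * q ^ k \<noteq> 1" for k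
    using cnz[of k] by (simp add: c_def d_def)
  have c1: "c * q * q ^ k \<noteq> 1" and c2: "c * q * q * q ^ k \<noteq> 1" for k
    using c0[of "Suc k"] c0[of "Suc (Suc k)"] by (simp_all add: mult.assoc)
  define f where "f n = (qsummand q a (b * q) c n + b * q * qsummand q (a * q) (b * q * q) (c * q * q) n)
      - (qsummand q a b c n + b * qsummand q a (b * q) (c * q) n)" for n
  \<comment> \<open>Here the polynomial part of the antidifference is just $bq^n$; the vanishing limit comes from it.\<close>
  define g where "g n = qpoch_inf q (1 * q ^ n) * qpoch_inf q (a * q ^ n) * qpoch_inf q (b * q * q ^ n)
      * qpoch_inf q (c * q * q ^ n) * inverse (qpoch_inf q (c * (q ^ n) ^ 2)) * (b * q ^ n)" for n
  have step: "f n = g (Suc n) - g n" for n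
  proof -
    define x where "x = q ^ n"
    define A where "A = qpoch_inf q (a * q * x)"
    define B where "B = qpoch_inf q (b * q * q * x)"
    define C where "C = qpoch_inf q (c * q * q * x)"
    define E where "E = inverse (qpoch_inf q (c * x ^ 2))"
    define Q where "Q = qpoch_inf q (q * x)"
    note step = qpoch_inf_step_mult[OF nq]
      and shift = inverse_qpoch_inf_step_mult[OF nq qpoch_inf_square_nonzero[OF nq], of _ n, folded x_def]
    have As: "qpoch_inf q (a * x) = (1 - a * x) * A"
      using step[of a x] by (simp add: A_def)
    have Bs: "qpoch_inf q (b * q * x) = (1 - b * q * x) * B"
         "qpoch_inf q (b * x) = (1 - b * x) * ((1 - b * q * x) * B)"
      using step[of b x] step[of "b * q" x] by (simp_all add: B_def)
    have Qs: "qpoch_inf q (1 * x) = (1 - x) * Q"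
      using step[of 1 x] by (simp add: Q_def)
    have Cs: "qpoch_inf q (c * q * x) = (1 - c * q * x) * C"
         "qpoch_inf q (c * x) = (1 - c * x) * ((1 - c * q * x) * C)"
      using step[of c x] step[of "c * q" x] by (simp_all add: C_def)
    have Es: "inverse (qpoch_inf q (c * q * x ^ 2)) = (1 - c * x ^ 2) * E"
         "inverse (qpoch_inf q (c * q * q * x ^ 2)) = (1 - c * q * x ^ 2) * ((1 - c * x ^ 2) * E)"
      using shift[OF c0] shift[OF c1] by (simp_all add: E_def)
    note vals = As Bs Qs Cs Es A_def[symmetric] B_def[symmetric] Q_def[symmetric]
      C_def[symmetric] E_def[symmetric]
    have t: "qsummand q a (b * q) c n = x * Q * ((1 - a * x) * A) * ((1 - b * q * x) * B)
        * ((1 - c * x) * ((1 - c * q * x) * C)) * E"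
      "qsummand q (a * q) (b * q * q) (c * q * q) n = x * Q * A * B
        * C * ((1 - c * q * x ^ 2) * ((1 - c * x ^ 2) * E))"
      "qsummand q a b c n = x * Q * ((1 - a * x) * A) * ((1 - b * x) * ((1 - b * q * x) * B))
        * ((1 - c * x) * ((1 - c * q * x) * C)) * E"
      "qsummand q a (b * q) (c * q) n = x * Q * ((1 - a * x) * A) * ((1 - b * q * x) * B)
        * ((1 - c * q * x) * C) * ((1 - c * x ^ 2) * E)"
      unfolding qsummand_eq_quotient[OF nq c0 x_def] qsummand_eq_quotient[OF nq c1 x_def]
        qsummand_eq_quotient[OF nq c2 x_def] vals
      by (rule refl)+
    have g0: "g n = (1 - x) * Q * ((1 - a * x) * A) * ((1 - b * q * x) * B) * ((1 - c * q * x) * C)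
        * E * (b * x)"
      unfolding g_def x_def[symmetric] vals by (rule refl)
    have g1: "g (Suc n) = Q * A * B * C * ((1 - c * q * x ^ 2) * ((1 - c * x ^ 2) * E)) * (b * (q * x))"
    proof -
      have qx: "q ^ Suc n = q * x" and assoc: "y * (q * x) = y * q * x" "c * (q * x) ^ 2 = c * q * q * x ^ 2" for y
        by (simp_all add: x_def power2_eq_square mult_ac)
      show ?thesis
        unfolding g_def qx assoc mult_1 vals by (rule refl)
    qed
    \<comment> \<open>All terms share the factor $QABCE$; what remains is a polynomial identity.\<close>
    let ?U = "Q * A * B * C * E"
    have "f n = ?U * (x * (1 - a * x) * (1 - b * q * x) * (1 - c * x) * (1 - c * q * x)
        + b * q * (x * (1 - c * q * x ^ 2) * (1 - c * x ^ 2)))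
        - ?U * (x * (1 - a * x) * (1 - b * x) * (1 - b * q * x) * (1 - c * x) * (1 - c * q * x)
          + b * (x * (1 - a * x) * (1 - b * q * x) * (1 - c * q * x) * (1 - c * x ^ 2)))"
      unfolding f_def t by (simp only: distrib_left mult_ac)
    moreover have "g (Suc n) = ?U * ((1 - c * q * x ^ 2) * (1 - c * x ^ 2) * (b * (q * x)))"
      unfolding g1 by (simp only: mult_ac)
    moreover have "g n = ?U * ((1 - x) * (1 - a * x) * (1 - b * q * x) * (1 - c * q * x) * (b * x))"
      unfolding g0 by (simp only: mult_ac)
    moreover have "x * (1 - a * x) * (1 - b * q * x) * (1 - c * x) * (1 - c * q * x)
        + b * q * (x * (1 - c * q * x ^ 2) * (1 - c * x ^ 2))
        - (x * (1 - a * x) * (1 - b * x) * (1 - b * q * x) * (1 - c * x) * (1 - c * q * x)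
           + b * (x * (1 - a * x) * (1 - b * q * x) * (1 - c * q * x) * (1 - c * x ^ 2)))
        = (1 - c * q * x ^ 2) * (1 - c * x ^ 2) * (b * (q * x))
          - (1 - x) * (1 - a * x) * (1 - b * q * x) * (1 - c * q * x) * (b * x)"
      unfolding b c_def by algebra
    ultimately show ?thesis
      by (simp only: right_diff_distrib[of ?U, symmetric])
  qed
  have lim: "g \<longlonglongrightarrow> 0"
  proof -
    have "g \<longlonglongrightarrow> 1 * 1 * 1 * 1 * inverse 1 * 0"
      unfolding g_def
      by (intro tendsto_intros qpoch_inf_tendsto_1[OF nq] tendsto_pow_0[OF nq]) simp
    then show ?thesis by simp
  qed
  have "f sums 0"
    by (rule sums_telescope_zero[OF step _ lim]) (simp add: g_def qpoch_inf_1[OF nq])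
  moreover have "f sums ((qseries q a (b * q) c + b * q * qseries q (a * q) (b * q * q) (c * q * q))
      - (qseries q a b c + b * qseries q a (b * q) (c * q)))"
    unfolding f_def qseries_def
    by (intro sums_add sums_diff sums_mult summable_sums summable_qsummand[OF nq])
  ultimately have "qseries q a (b * q) c + b * q * qseries q (a * q) (b * q * q) (c * q * q)
      = qseries q a b c + b * qseries q a (b * q) (c * q)"
    using sums_unique2 by fastforce
  moreover have "a * b / q ^ 2 = c" "a * b = c * q * q" "a * (b * q) / q ^ 2 = c * q"
    using q0 by (simp_all add: c_def d_def field_simps power2_eq_square)
  ultimately show ?thesis
    by (simp only: V_def)
qed

section \<open>The partial theta function\<close>

lemma partial_theta_coeff_Suc: "partial_theta_coeff q (Suc n) = - (q ^ n) * partial_theta_coeff q n"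
proof -
  have "Suc n * (Suc n - 1) div 2 = n + n * (n - 1) div 2"
  proof -
    have "Suc n * (Suc n - 1) = 2 * n + n * (n - 1)"
      by (cases n) (simp_all add: algebra_simps)
    then show ?thesis by simp
  qed
  then show ?thesis
    by (simp add: partial_theta_coeff_def power_add)
qed

lemma partial_theta_term_tendsto_0:
  assumes "norm q < 1"
  shows "(\<lambda>n. partial_theta_coeff q n * a ^ n) \<longlonglongrightarrow> 0"
proof -
  have "(\<lambda>n. norm (a * q ^ n)) \<longlonglongrightarrow> 0"
    using tendsto_norm[OF tendsto_pow_0(1)[OF assms, of a]] by simp
  then have "\<forall>\<^sub>F n in sequentially. norm (a * q ^ n) < 1 / 2"
    by (rule order_tendstoD) simp
  then obtain N where N: "\<And>n. n \<ge> N \<Longrightarrow> norm (a * q ^ n) < 1 / 2"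
    unfolding eventually_sequentially by blast
  have "summable (\<lambda>n. partial_theta_coeff q n * a ^ n)"
  proof (rule summable_ratio_test[of "1/2" N])
    fix n assume "n \<ge> N"
    have "norm (partial_theta_coeff q (Suc n) * a ^ Suc n)
            = norm (a * q ^ n) * norm (partial_theta_coeff q n * a ^ n)"
      by (simp add: partial_theta_coeff_Suc norm_mult mult_ac)
    also have "\<dots> \<le> 1 / 2 * norm (partial_theta_coeff q n * a ^ n)"
      using N[OF \<open>n \<ge> N\<close>] by (intro mult_right_mono) auto
    finally show "norm (partial_theta_coeff q (Suc n) * a ^ Suc n)
        \<le> 1 / 2 * norm (partial_theta_coeff q n * a ^ n)" .
  qed simp
  then show ?thesis by (rule summable_LIMSEQ_zero)
qed

text \<open>
  Unrolling the recurrence $n$ times gives $L(a) = \sum_{k<n} \tau(k)a^k + \tau(n)a^nL(aq^n)$. The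
  remainder tends to $0$ since $\tau(n)a^n$ does and $L$ stays bounded.
\<close>

lemma partial_theta_eqI:
  assumes nq: "norm q < 1"
    and rec: "\<And>n. L (a * q ^ n) = 1 - a * q ^ n * L (a * q ^ Suc n)"
    and bound: "\<And>n. norm (L (a * q ^ n)) \<le> K"
  shows "partial_theta q a = L a"
proof -
  define t where "t n = partial_theta_coeff q n * a ^ n" for n
  have partial: "L a = (\<Sum>k<n. t k) + t n * L (a * q ^ n)" for n
  proof (induction n)
    case (Suc n)
    have "t (Suc n) = - (a * q ^ n) * t n"
      by (simp add: t_def partial_theta_coeff_Suc)
    moreover have "L a = (\<Sum>k<n. t k) + t n * (1 - a * q ^ n * L (a * q ^ Suc n))"
      using Suc by (simp only: rec[of n, symmetric])
    ultimately show ?case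
      by (simp add: algebra_simps)
  qed (simp add: t_def partial_theta_coeff_def)
  have "Bfun (\<lambda>n. L (a * q ^ n)) sequentially"
    by (rule BfunI[of _ K]) (simp add: bound)
  moreover have "Zfun t sequentially"
    using partial_theta_term_tendsto_0[OF nq, of a] by (simp add: tendsto_Zfun_iff t_def[abs_def])
  ultimately have "Zfun (\<lambda>n. t n * L (a * q ^ n)) sequentially"
    by (intro bounded_bilinear.Zfun_prod_Bfun[OF bounded_bilinear_mult])
  then have "(\<lambda>n. t n * L (a * q ^ n)) \<longlonglongrightarrow> 0"
    by (simp add: tendsto_Zfun_iff)
  then have "(\<lambda>n. L a - t n * L (a * q ^ n)) \<longlonglongrightarrow> L a - 0"
    by (intro tendsto_diff tendsto_const)
  moreover have "L a - t n * L (a * q ^ n) = (\<Sum>k<n. t k)" for n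
    using partial[of n] by simp
  ultimately have "t sums L a"
    by (simp add: sums_def)
  then show ?thesis
    unfolding partial_theta_def t_def by (rule sums_unique[symmetric])
qed

lemma norm_V_le:
  assumes "norm q < 1" "norm x \<le> norm a" "norm y \<le> norm b"
  shows "norm (V q x y) \<le> exp ((1 + norm a + norm b + norm (a * b / q ^ 2)) / (1 - norm q)) / (1 - norm q)"
  unfolding V_def
  by (rule norm_qseries_le) (use assms in \<open>auto simp: norm_mult norm_divide intro!: divide_right_mono mult_mono\<close>)

lemma partial_theta_eq_V:
  assumes nq: "norm q < 1" and q0: "q \<noteq> 0" and cnz: "\<And>k::nat. a * b / q ^ 2 * q ^ k \<noteq> 1"
  shows "partial_theta q a = V q a b + b * V q (a * q) (b * q)"
proof (rule partial_theta_eqI[OF nq, where L = "\<lambda>a. V q a b + b * V q (a * q) (b * q)"])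
  fix n :: nat
  have cnz': "a * q ^ n * b / q ^ 2 * q ^ k \<noteq> 1" for k :: nat
    using cnz[of "n + k"] by (simp add: power_add mult_ac)
  show "V q (a * q ^ n) b + b * V q (a * q ^ n * q) (b * q) =
      1 - a * q ^ n * (V q (a * q ^ Suc n) b + b * V q (a * q ^ Suc n * q) (b * q))"
    using V_recurrence[OF nq q0 cnz'] by (simp add: algebra_simps)
next
  fix n :: nat
  define K where "K = exp ((1 + norm a + norm b + norm (a * b / q ^ 2)) / (1 - norm q)) / (1 - norm q)"
  have shrink: "norm (x * q ^ k) \<le> norm x" for x k
    using nq by (simp add: norm_mult norm_power mult_left_le power_le_one)
  have "norm (V q (a * q ^ n) b) \<le> K" "norm (V q (a * q ^ n * q) (b * q)) \<le> K"
    using norm_V_le[OF nq shrink[of a n] order.refl, of b]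
      norm_V_le[OF nq shrink[of a "Suc n"] shrink[of b 1]] by (simp_all add: K_def mult_ac)
  then show "norm (V q (a * q ^ n) b + b * V q (a * q ^ n * q) (b * q)) \<le> K + norm b * K"
    by (intro norm_triangle_mono) (auto simp: norm_mult intro: mult_left_mono)
qed

theorem theorem1p10:
  fixes q a b :: complex
  assumes "0 < norm q" and "norm q < 1"
    and "\<And>k::nat. a * q ^ k \<noteq> 1"
    and "\<And>k::nat. b * q ^ k \<noteq> 1"
    and "\<And>k::nat. a * b / q ^ 3 * q ^ k \<noteq> 1"
    and "q + b \<noteq> 0"
  shows "partial_theta q a =
           q / (q + b) * P q a b
         + b * (1 + q) / (q + b) * P q (a * q) (b * q)
         + b ^ 2 * q / (q + b) * P q (a * q ^ 2) (b * q ^ 2)"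
proof -
  note nq = assms(2)
  have q0: "q \<noteq> 0" using assms(1) by auto
  \<comment> \<open>The contiguity relation produces $V(a,b/q)$; writing $b = dq$ avoids the quotient.\<close>
  define d where "d = b / q"
  have b: "b = d * q" using q0 by (simp add: d_def)
  have c0: "a * d / q ^ 2 * q ^ k \<noteq> 1" for k
    using assms(5)[of k] by (simp add: d_def power3_eq_cube power2_eq_square mult_ac)
  have c1: "a * b / q ^ 2 * q ^ k \<noteq> 1" for k
    using c0[of "Suc k"] by (simp add: b mult_ac)
  have c2: "a * q * b / q ^ 2 * q ^ k \<noteq> 1" for k
    using c1[of "Suc k"] by (simp add: mult_ac)
  have a_pow: "a * q ^ j * q ^ k \<noteq> 1" and b_pow: "b * q ^ j * q ^ k \<noteq> 1" for j k
    using assms(3,4)[of "j + k"] by (simp_all add: power_add mult_ac)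
  have c_pow: "(a * q ^ j) * (b * q ^ j) / q ^ 3 * q ^ k \<noteq> 1" for j k
    using assms(5)[of "j + j + k"] by (simp add: power_add mult_ac)
  have P_shift: "P q (a * q ^ j) (b * q ^ j) = qseries q (a * q ^ j) (b * q ^ j) ((a * q ^ j) * (b * q ^ j) / q ^ 3)"
    for j by (rule P_eq_qseries[OF nq q0 a_pow b_pow c_pow])
  have P0: "P q a b = qseries q a (d * q) (a * d / q ^ 2)"
    and P1: "P q (a * q) (b * q) = qseries q (a * q) (d * q * q) (a * d)"
    and P1': "P q (a * q) (b * q) = qseries q (a * q) (b * q) (a * q * b / q ^ 2)"
    and P2: "P q (a * q ^ 2) (b * q ^ 2) = qseries q (a * q * q) (b * q * q) (a * q * b)"
    using P_shift[of 0] P_shift[of 1] P_shift[of 2] q0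
    by (simp_all add: b power2_eq_square power3_eq_cube mult_ac)
  have "P q a b + b * P q (a * q) (b * q) = V q a d + d * V q a b"
    using qseries_contiguous[OF nq q0 c0] by (simp only: P0 P1 b[symmetric])
  moreover have "P q (a * q) (b * q) + b * q * P q (a * q ^ 2) (b * q ^ 2) = V q (a * q) b + b * V q (a * q) (b * q)"
    using qseries_contiguous[OF nq q0 c2] by (simp only: P1' P2)
  moreover have "partial_theta q a = V q a d + d * V q (a * q) b"
    using partial_theta_eq_V[OF nq q0 c0] by (simp only: b[symmetric])
  moreover have "partial_theta q a = V q a b + b * V q (a * q) (b * q)"
    by (rule partial_theta_eq_V[OF nq q0 c1])
  ultimately have "(q + b) * partial_theta q a = q * P q a b + b * (1 + q) * P q (a * q) (b * q)
      + b ^ 2 * q * P q (a * q ^ 2) (b * q ^ 2)"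
    using b by algebra
  then have "partial_theta q a = (q * P q a b + b * (1 + q) * P q (a * q) (b * q)
      + b ^ 2 * q * P q (a * q ^ 2) (b * q ^ 2)) / (q + b)"
    using assms(6) by (simp add: nonzero_eq_divide_eq mult.commute)
  then show ?thesis
    by (simp add: add_divide_distrib)
qed

end
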